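(* Let $(M,I,J,K,g_M)$ be a hyperkähler manifold, $(N,g_N)$ a Riemannian manifold, and $F:(M,g_M)\to(N,g_N)$ a h-Lagrangian submersion such that $(I,J,K)$ is a h-Lagrangian basis, i.e. $F$ is a Riemannian submersion with $I(\ker F_* )=(\ker F_* )^{\perp}$, $J(\ker F_* )=\ker F_*$ and $K(\ker F_* )=(\ker F_* )^{\perp}$. Then the following conditions are equivalent: a) the distribution $(\ker F_* )^{\perp}$ is integrable; b) $\mathcal{A}_X IY=\mathcal{A}_Y IX$ for all $X,Y\in\Gamma((\ker F_* )^{\perp})$; c) $\mathcal{A}_X KY=\mathcal{A}_Y KX$ for all $X,Y\in\Gamma((\ker F_* )^{\perp})$; d) $\mathcal{A}_X JY=\mathcal{A}_Y JX$ for all $X,Y\in\Gamma((\ker F_* )^{\perp})$.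
   Context: A hyperkähler manifold $(M,I,J,K,g_M)$ is a $4m$-dimensional Riemannian manifold with endomorphism fields $I,J,K$ of $TM$ satisfying $I^2=J^2=K^2=-\mathrm{id}$, $IJ=-JI=K$, $JK=-KJ=I$, $KI=-IK=J$, $g_M(RX,RY)=g_M(X,Y)$ for $R\in\{I,J,K\}$, and $\nabla I=\nabla J=\nabla K=0$, where $\nabla$ is the Levi-Civita connection of $g_M$. A Riemannian submersion $F:(M,g_M)\to(N,g_N)$ is a smooth surjective submersion such that $(F_* )_p:(\ker (F_* )_p)^{\perp}\to T_{F(p)}N$ is a linear isometry for every $p\in M$. For a vector field $U$ on $M$ write $U=\mathcal{V}U+\mathcal{H}U$ with $\mathcal{V}U\in\Gamma(\ker F_* )$ and $\mathcal{H}U\in\Gamma((\ker F_* )^{\perp})$. The O'Neill tensor $\mathcal{A}$ is $$\mathcal{A}_U W=\mathcal{H}\nabla_{\mathcal{H}U}\mathcal{V}W+\mathcal{V}\nabla_{\mathcal{H}U}\mathcal{H}W .$$ *)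

theory Defs
  imports "HOL-Analysis.Analysis" "HOL-Library.Function_Algebras"
begin

section \<open>Smooth manifolds\<close>

text \<open>
  \<open>Ck_on k f S\<close> is meant for open \<open>S\<close>; then the derivative at a point of \<open>S\<close> does not
  depend on the values of \<open>f\<close> outside \<open>S\<close>. The domain is finite-dimensional, so
  smoothness of all directional derivatives is smoothness of the derivative.
\<close>

primrec Ck_on ::
    "nat \<Rightarrow> ('e::euclidean_space \<Rightarrow> 'f::real_normed_vector) \<Rightarrow> 'e set \<Rightarrow> bool" where
  "Ck_on 0 f S \<longleftrightarrow> continuous_on S f"
| "Ck_on (Suc k) f S \<longleftrightarrow>
     (\<forall>x\<in>S. f differentiable (at x)) \<and>
     (\<forall>v. Ck_on k (\<lambda>x. frechet_derivative f (at x) v) S)"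

definition smooth_on :: "('e::euclidean_space \<Rightarrow> 'f::real_normed_vector) \<Rightarrow> 'e set \<Rightarrow> bool" where
  "smooth_on f S \<longleftrightarrow> (\<forall>k. Ck_on k f S)"

text \<open>
  The underlying space of a manifold is a type \<open>'a\<close> carrying a Hausdorff, second countable
  topology; the smooth structure is given by a (not necessarily maximal) atlas of charts
  \<open>(U, \<phi>)\<close> onto open subsets of the Euclidean model space \<open>'e\<close>. The values of \<open>\<phi>\<close> outside
  \<open>U\<close> are irrelevant. The dimension is \<open>DIM('e)\<close>.
\<close>

type_synonym ('a, 'e) chart = "'a set \<times> ('a \<Rightarrow> 'e)"

definition is_chart :: "'a::topological_space set \<Rightarrow> ('a \<Rightarrow> 'e::euclidean_space) \<Rightarrow> bool" where
  "is_chart U \<phi> \<longleftrightarrow> open U \<and> open (\<phi> ` U) \<and> homeomorphism U (\<phi> ` U) \<phi> (inv_into U \<phi>)"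

definition smooth_atlas ::
    "('a::{t2_space, second_countable_topology}, 'e::euclidean_space) chart set \<Rightarrow> bool" where
  "smooth_atlas A \<longleftrightarrow>
     (\<forall>(U, \<phi>)\<in>A. is_chart U \<phi>) \<and>
     (\<Union>(U, \<phi>)\<in>A. U) = UNIV \<and>
     (\<forall>(U, \<phi>)\<in>A. \<forall>(V, \<psi>)\<in>A. smooth_on (\<psi> \<circ> inv_into U \<phi>) (\<phi> ` (U \<inter> V)))"

definition smooth_functions ::
    "('a::{t2_space, second_countable_topology}, 'e::euclidean_space) chart set
       \<Rightarrow> ('a \<Rightarrow> real) set" where
  "smooth_functions A = {f. \<forall>(U, \<phi>)\<in>A. smooth_on (f \<circ> inv_into U \<phi>) (\<phi> ` U)}"

definition smooth_map ::
    "('a::{t2_space, second_countable_topology}, 'e::euclidean_space) chart set \<Rightarrow>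
     ('b::{t2_space, second_countable_topology}, 'f::euclidean_space) chart set \<Rightarrow>
     ('a \<Rightarrow> 'b) \<Rightarrow> bool" where
  "smooth_map A B F \<longleftrightarrow>
     continuous_on UNIV F \<and>
     (\<forall>(U, \<phi>)\<in>A. \<forall>(V, \<psi>)\<in>B. smooth_on (\<psi> \<circ> F \<circ> inv_into U \<phi>) (\<phi> ` (U \<inter> F -` V)))"


section \<open>Tangent vectors and vector fields\<close>

text \<open>
  Tangent vectors at \<open>p\<close> are the derivations at \<open>p\<close> of the algebra of smooth functions. As HOL
  functions are total, a tangent vector is required to vanish on functions that are not
  smooth, so that equality of tangent vectors is equality of derivations. Addition, zero
  and negation of tangent vectors (and of vector fields) are the pointwise ones.
\<close>

type_synonym 'a tvec = "('a \<Rightarrow> real) \<Rightarrow> real"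
type_synonym 'a vfield = "'a \<Rightarrow> 'a tvec"

definition tscale :: "real \<Rightarrow> 'a tvec \<Rightarrow> 'a tvec"  (infixr \<open>*\<^sub>t\<close> 75) where
  "r *\<^sub>t v = (\<lambda>f. r * v f)"

definition fscale :: "('a \<Rightarrow> real) \<Rightarrow> 'a vfield \<Rightarrow> 'a vfield"  (infixr \<open>*\<^sub>f\<close> 75) where
  "f *\<^sub>f X = (\<lambda>p. f p *\<^sub>t X p)"

definition tangent_space ::
    "('a::{t2_space, second_countable_topology}, 'e::euclidean_space) chart set
       \<Rightarrow> 'a \<Rightarrow> 'a tvec set" where
  "tangent_space A p = {v.
     (\<forall>f. f \<notin> smooth_functions A \<longrightarrow> v f = 0) \<and>
     (\<forall>f\<in>smooth_functions A. \<forall>h\<in>smooth_functions A. v (f + h) = v f + v h) \<and>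
     (\<forall>f\<in>smooth_functions A. \<forall>r. v (\<lambda>x. r * f x) = r * v f) \<and>
     (\<forall>f\<in>smooth_functions A. \<forall>h\<in>smooth_functions A. v (f * h) = f p * v h + h p * v f)}"

definition vector_fields ::
    "('a::{t2_space, second_countable_topology}, 'e::euclidean_space) chart set
       \<Rightarrow> 'a vfield set" where
  "vector_fields A = {X.
     (\<forall>p. X p \<in> tangent_space A p) \<and>
     (\<forall>f\<in>smooth_functions A. (\<lambda>p. X p f) \<in> smooth_functions A)}"

definition lie_bracket :: "'a vfield \<Rightarrow> 'a vfield \<Rightarrow> 'a vfield" where
  "lie_bracket X Y = (\<lambda>p f. X p (\<lambda>q. Y q f) - Y p (\<lambda>q. X q f))"

definition differential ::
    "('b::{t2_space, second_countable_topology}, 'f::euclidean_space) chart set \<Rightarrow>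
     ('a \<Rightarrow> 'b) \<Rightarrow> 'a tvec \<Rightarrow> 'b tvec" where
  "differential B F v = (\<lambda>h. if h \<in> smooth_functions B then v (h \<circ> F) else 0)"

definition sections ::
    "('a::{t2_space, second_countable_topology}, 'e::euclidean_space) chart set \<Rightarrow>
     ('a \<Rightarrow> 'a tvec set) \<Rightarrow> 'a vfield set" where
  "sections A D = {X \<in> vector_fields A. \<forall>p. X p \<in> D p}"

text \<open>
  Integrability of a distribution in the infinitesimal sense customary for Riemannian
  submersions: the module of sections is closed under the Lie bracket (also called complete
  integrability or involutivity).
\<close>

definition integrable_distribution ::
    "('a::{t2_space, second_countable_topology}, 'e::euclidean_space) chart set \<Rightarrow>
     ('a \<Rightarrow> 'a tvec set) \<Rightarrow> bool" where
  "integrable_distribution A D \<longleftrightarrow>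
     (\<forall>X\<in>sections A D. \<forall>Y\<in>sections A D. lie_bracket X Y \<in> sections A D)"


section \<open>Riemannian metrics and the Levi-Civita connection\<close>

type_synonym 'a metric_field = "'a \<Rightarrow> 'a tvec \<Rightarrow> 'a tvec \<Rightarrow> real"
type_synonym 'a endo_field = "'a \<Rightarrow> 'a tvec \<Rightarrow> 'a tvec"

definition riemannian_metric ::
    "('a::{t2_space, second_countable_topology}, 'e::euclidean_space) chart set \<Rightarrow>
     'a metric_field \<Rightarrow> bool" where
  "riemannian_metric A g \<longleftrightarrow>
     (\<forall>p. \<forall>u\<in>tangent_space A p. \<forall>v\<in>tangent_space A p. \<forall>w\<in>tangent_space A p. \<forall>r.
        g p u v = g p v u \<and>
        g p (u + v) w = g p u w + g p v w \<and>
        g p (r *\<^sub>t u) w = r * g p u w) \<and>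
     (\<forall>p. \<forall>v\<in>tangent_space A p. v \<noteq> 0 \<longrightarrow> g p v v > 0) \<and>
     (\<forall>X\<in>vector_fields A. \<forall>Y\<in>vector_fields A. (\<lambda>p. g p (X p) (Y p)) \<in> smooth_functions A)"

definition riemannian_manifold ::
    "('a::{t2_space, second_countable_topology}, 'e::euclidean_space) chart set \<Rightarrow>
     'a metric_field \<Rightarrow> bool" where
  "riemannian_manifold A g \<longleftrightarrow> smooth_atlas A \<and> riemannian_metric A g"

text \<open>\<open>nab X Y\<close> stands for the covariant derivative of \<open>Y\<close> along \<open>X\<close>.\<close>

definition affine_connection ::
    "('a::{t2_space, second_countable_topology}, 'e::euclidean_space) chart set \<Rightarrow>
     ('a vfield \<Rightarrow> 'a vfield \<Rightarrow> 'a vfield) \<Rightarrow> bool" where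
  "affine_connection A nab \<longleftrightarrow>
     (\<forall>X\<in>vector_fields A. \<forall>Y\<in>vector_fields A. nab X Y \<in> vector_fields A) \<and>
     (\<forall>X\<in>vector_fields A. \<forall>Y\<in>vector_fields A. \<forall>Z\<in>vector_fields A.
        nab (X + Y) Z = nab X Z + nab Y Z \<and> nab X (Y + Z) = nab X Y + nab X Z) \<and>
     (\<forall>X\<in>vector_fields A. \<forall>Y\<in>vector_fields A. \<forall>f\<in>smooth_functions A.
        nab (f *\<^sub>f X) Y = f *\<^sub>f nab X Y \<and>
        nab X (f *\<^sub>f Y) = (\<lambda>p. X p f) *\<^sub>f Y + f *\<^sub>f nab X Y)"

text \<open>
  By the fundamental theorem of Riemannian geometry there is exactly one such connection
  (as an operation on smooth vector fields).
\<close>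

definition levi_civita ::
    "('a::{t2_space, second_countable_topology}, 'e::euclidean_space) chart set \<Rightarrow>
     'a metric_field \<Rightarrow> ('a vfield \<Rightarrow> 'a vfield \<Rightarrow> 'a vfield) \<Rightarrow> bool" where
  "levi_civita A g nab \<longleftrightarrow>
     affine_connection A nab \<and>
     (\<forall>X\<in>vector_fields A. \<forall>Y\<in>vector_fields A. nab X Y - nab Y X = lie_bracket X Y) \<and>
     (\<forall>X\<in>vector_fields A. \<forall>Y\<in>vector_fields A. \<forall>Z\<in>vector_fields A. \<forall>p.
        X p (\<lambda>q. g q (Y q) (Z q)) = g p (nab X Y p) (Z p) + g p (Y p) (nab X Z p))"


section \<open>Hyperkaehler manifolds\<close>

definition app_field :: "'a endo_field \<Rightarrow> 'a vfield \<Rightarrow> 'a vfield"  (infixr \<open>\<cdot>\<^sub>e\<close> 80) where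
  "R \<cdot>\<^sub>e X = (\<lambda>p. R p (X p))"

definition endomorphism_field ::
    "('a::{t2_space, second_countable_topology}, 'e::euclidean_space) chart set \<Rightarrow>
     'a endo_field \<Rightarrow> bool" where
  "endomorphism_field A R \<longleftrightarrow>
     (\<forall>p. \<forall>u\<in>tangent_space A p. \<forall>v\<in>tangent_space A p. \<forall>r.
        R p u \<in> tangent_space A p \<and>
        R p (u + v) = R p u + R p v \<and> R p (r *\<^sub>t u) = r *\<^sub>t R p u) \<and>
     (\<forall>X\<in>vector_fields A. R \<cdot>\<^sub>e X \<in> vector_fields A)"

definition hyperkaehler ::
    "('a::{t2_space, second_countable_topology}, 'e::euclidean_space) chart set \<Rightarrow>
     'a metric_field \<Rightarrow> ('a vfield \<Rightarrow> 'a vfield \<Rightarrow> 'a vfield) \<Rightarrow>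
     'a endo_field \<Rightarrow> 'a endo_field \<Rightarrow> 'a endo_field \<Rightarrow> bool" where
  "hyperkaehler A g nab I J K \<longleftrightarrow>
     riemannian_manifold A g \<and> levi_civita A g nab \<and>
     (\<exists>m. DIM('e) = 4 * m) \<and>
     (\<forall>R\<in>{I, J, K}.
        endomorphism_field A R \<and>
        (\<forall>p. \<forall>v\<in>tangent_space A p. R p (R p v) = - v) \<and>
        (\<forall>p. \<forall>v\<in>tangent_space A p. \<forall>w\<in>tangent_space A p. g p (R p v) (R p w) = g p v w) \<and>
        (\<forall>X\<in>vector_fields A. \<forall>Y\<in>vector_fields A. nab X (R \<cdot>\<^sub>e Y) - R \<cdot>\<^sub>e nab X Y = 0)) \<and>
     (\<forall>p. \<forall>v\<in>tangent_space A p.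
        I p (J p v) = K p v \<and> - J p (I p v) = K p v \<and>
        J p (K p v) = I p v \<and> - K p (J p v) = I p v \<and>
        K p (I p v) = J p v \<and> - I p (K p v) = J p v)"


section \<open>Riemannian submersions and the O'Neill tensor\<close>

definition ker_diff ::
    "('a::{t2_space, second_countable_topology}, 'e::euclidean_space) chart set \<Rightarrow>
     ('b::{t2_space, second_countable_topology}, 'f::euclidean_space) chart set \<Rightarrow>
     ('a \<Rightarrow> 'b) \<Rightarrow> 'a \<Rightarrow> 'a tvec set" where
  "ker_diff A B F p = {v \<in> tangent_space A p. differential B F v = 0}"

definition orth ::
    "('a::{t2_space, second_countable_topology}, 'e::euclidean_space) chart set \<Rightarrow>
     'a metric_field \<Rightarrow> ('a \<Rightarrow> 'a tvec set) \<Rightarrow> 'a \<Rightarrow> 'a tvec set" where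
  "orth A g D p = {v \<in> tangent_space A p. \<forall>w\<in>D p. g p v w = 0}"

definition riemannian_submersion ::
    "('a::{t2_space, second_countable_topology}, 'e::euclidean_space) chart set \<Rightarrow>
     'a metric_field \<Rightarrow>
     ('b::{t2_space, second_countable_topology}, 'f::euclidean_space) chart set \<Rightarrow>
     'b metric_field \<Rightarrow> ('a \<Rightarrow> 'b) \<Rightarrow> bool" where
  "riemannian_submersion A gM B gN F \<longleftrightarrow>
     smooth_map A B F \<and> surj F \<and>
     (\<forall>p. differential B F ` tangent_space A p = tangent_space B (F p)) \<and>
     (\<forall>p. bij_betw (differential B F) (orth A gM (ker_diff A B F) p) (tangent_space B (F p)) \<and>
        (\<forall>v\<in>orth A gM (ker_diff A B F) p. \<forall>w\<in>orth A gM (ker_diff A B F) p.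
           gN (F p) (differential B F v) (differential B F w) = gM p v w))"

text \<open>
  The two components of a vector field with respect to an orthogonal splitting of the tangent
  bundle into \<open>D\<close> and its orthogonal complement.
\<close>

definition tan_part ::
    "('a::{t2_space, second_countable_topology}, 'e::euclidean_space) chart set \<Rightarrow>
     'a metric_field \<Rightarrow> ('a \<Rightarrow> 'a tvec set) \<Rightarrow> 'a vfield \<Rightarrow> 'a vfield" where
  "tan_part A g D U = (\<lambda>p. THE v. v \<in> D p \<and> U p - v \<in> orth A g D p)"

definition orth_part ::
    "('a::{t2_space, second_countable_topology}, 'e::euclidean_space) chart set \<Rightarrow>
     'a metric_field \<Rightarrow> ('a \<Rightarrow> 'a tvec set) \<Rightarrow> 'a vfield \<Rightarrow> 'a vfield" where
  "orth_part A g D U = (\<lambda>p. THE h. h \<in> orth A g D p \<and> U p - h \<in> D p)"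

definition oneill_A ::
    "('a::{t2_space, second_countable_topology}, 'e::euclidean_space) chart set \<Rightarrow>
     'a metric_field \<Rightarrow> ('a vfield \<Rightarrow> 'a vfield \<Rightarrow> 'a vfield) \<Rightarrow>
     ('b::{t2_space, second_countable_topology}, 'f::euclidean_space) chart set \<Rightarrow>
     ('a \<Rightarrow> 'b) \<Rightarrow> 'a vfield \<Rightarrow> 'a vfield \<Rightarrow> 'a vfield" where
  "oneill_A A g nab B F U W =
     (let \<V> = tan_part A g (ker_diff A B F);
          \<H> = orth_part A g (ker_diff A B F)
      in \<H> (nab (\<H> U) (\<V> W)) + \<V> (nab (\<H> U) (\<H> W)))"

definition h_lagrangian_submersion ::
    "('a::{t2_space, second_countable_topology}, 'e::euclidean_space) chart set \<Rightarrow>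
     'a metric_field \<Rightarrow>
     ('b::{t2_space, second_countable_topology}, 'f::euclidean_space) chart set \<Rightarrow>
     'b metric_field \<Rightarrow> ('a \<Rightarrow> 'b) \<Rightarrow>
     'a endo_field \<Rightarrow> 'a endo_field \<Rightarrow> 'a endo_field \<Rightarrow> bool" where
  "h_lagrangian_submersion A gM B gN F I J K \<longleftrightarrow>
     riemannian_submersion A gM B gN F \<and>
     (\<forall>p. I p ` ker_diff A B F p = orth A gM (ker_diff A B F) p \<and>
          J p ` ker_diff A B F p = ker_diff A B F p \<and>
          K p ` ker_diff A B F p = orth A gM (ker_diff A B F) p)"

end

theory Submission
  imports Defs
begin

text \<open>
  For horizontal \<open>X\<close>, \<open>Y\<close> and \<open>R \<in> {I, J, K}\<close>, parallelism of \<open>R\<close> gives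
  \<open>\<nabla>\<^sub>X(RY) = R(\<nabla>\<^sub>X Y)\<close>. Since \<open>J\<close> preserves the vertical and horizontal distributions while
  \<open>I\<close> and \<open>K\<close> exchange them, in all three cases \<open>\<A>\<^sub>X(RY) = R(\<V>\<nabla>\<^sub>X Y)\<close>. As \<open>R\<close> is injective,
  each of the three conditions says that \<open>\<V>\<nabla>\<^sub>X Y\<close> is symmetric in \<open>X\<close>, \<open>Y\<close>, which by
  torsion-freeness means \<open>\<V>[X,Y] = 0\<close>.
\<close>

section \<open>Differences of smooth functions and of vector fields\<close>

lemma Ck_on_cong:
  assumes "open S" "\<And>x. x \<in> S \<Longrightarrow> f x = g x" "Ck_on k f S"
  shows "Ck_on k g S"
  using assms(2,3)
proof (induction k arbitrary: f g)
  case 0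
  then show ?case using continuous_on_cong[of S S f g] by (metis Ck_on.simps(1))
next
  case (Suc k)
  \<comment> \<open>The derivative at \<open>x\<close> is local and \<open>S\<close> is open, so
    agreement on \<open>S\<close> forces equal derivatives there, whatever happens outside.\<close>
  have d: "(g has_derivative frechet_derivative f (at x)) (at x)" if "x \<in> S" for x
  proof (rule has_derivative_transform_within_open[OF _ \<open>open S\<close> that])
    show "(f has_derivative frechet_derivative f (at x)) (at x)"
      using Suc.prems(2) that by (simp flip: frechet_derivative_works)
  qed (rule Suc.prems(1))
  have fd: "frechet_derivative f (at x) = frechet_derivative g (at x)" if "x \<in> S" for x
    using frechet_derivative_at[OF d[OF that]] .
  show ?case
    unfolding Ck_on.simps
  proof (intro conjI ballI allI)
    show "g differentiable (at x)" if "x \<in> S" for x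
      using d[OF that] by (rule differentiableI)
    show "Ck_on k (\<lambda>x. frechet_derivative g (at x) v) S" for v
      by (rule Suc.IH[of "\<lambda>x. frechet_derivative f (at x) v"]) (use Suc.prems fd in auto)
  qed
qed

lemma Ck_on_diff:
  assumes "open S" "Ck_on k f S" "Ck_on k g S"
  shows "Ck_on k (\<lambda>x. f x - g x) S"
  using assms(2,3)
proof (induction k arbitrary: f g)
  case 0
  then show ?case by (simp add: continuous_on_diff)
next
  case (Suc k)
  have d: "((\<lambda>x. f x - g x) has_derivative
      (\<lambda>v. frechet_derivative f (at x) v - frechet_derivative g (at x) v)) (at x)"
    if "x \<in> S" for x
    using Suc.prems that by (intro has_derivative_diff iffD1[OF frechet_derivative_works]) simp_all
  have fd: "frechet_derivative (\<lambda>x. f x - g x) (at x) v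
      = frechet_derivative f (at x) v - frechet_derivative g (at x) v" if "x \<in> S" for x v
    using frechet_derivative_at[OF d[OF that]] by metis
  show ?case
    unfolding Ck_on.simps
  proof (intro conjI ballI allI)
    show "(\<lambda>x. f x - g x) differentiable (at x)" if "x \<in> S" for x
      using d[OF that] by (rule differentiableI)
    show "Ck_on k (\<lambda>x. frechet_derivative (\<lambda>x. f x - g x) (at x) v) S" for v
    \<comment> \<open>The difference formula for derivatives is known only on \<open>S\<close>,
      where both functions are differentiable, so plain rewriting is not enough.\<close>
    proof (rule Ck_on_cong[OF \<open>open S\<close> fd[symmetric]])
      show "Ck_on k (\<lambda>x. frechet_derivative f (at x) v - frechet_derivative g (at x) v) S"
        by (rule Suc.IH) (use Suc.prems in auto)
    qed
  qed
qed

text \<open>Through \<open>vector_fields_diff\<close> this yields smoothness of the zero field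
  \<open>X - X\<close> and of the bracket, written as a difference of covariant derivatives.\<close>

lemma smooth_functions_diff:
  assumes "smooth_atlas A" "f \<in> smooth_functions A" "g \<in> smooth_functions A"
  shows "(\<lambda>p. f p - g p) \<in> smooth_functions A"
  unfolding smooth_functions_def
proof (intro CollectI ballI, clarify)
  fix U \<phi> assume U: "(U, \<phi>) \<in> A"
  have "open (\<phi> ` U)"
    using assms(1) U by (auto simp: smooth_atlas_def is_chart_def)
  moreover have "smooth_on (f \<circ> inv_into U \<phi>) (\<phi> ` U)" "smooth_on (g \<circ> inv_into U \<phi>) (\<phi> ` U)"
    using assms(2,3) U by (auto simp: smooth_functions_def)
  ultimately show "smooth_on ((\<lambda>p. f p - g p) \<circ> inv_into U \<phi>) (\<phi> ` U)"
    by (simp add: smooth_on_def o_def Ck_on_diff)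
qed

lemma tangent_space_diff:
  "u \<in> tangent_space A p \<Longrightarrow> v \<in> tangent_space A p \<Longrightarrow> u - v \<in> tangent_space A p"
  by (simp add: tangent_space_def algebra_simps)

lemma vector_fields_tangent: "X \<in> vector_fields A \<Longrightarrow> X p \<in> tangent_space A p"
  by (simp add: vector_fields_def)

lemma vector_fields_diff:
  "smooth_atlas A \<Longrightarrow> X \<in> vector_fields A \<Longrightarrow> Y \<in> vector_fields A \<Longrightarrow> X - Y \<in> vector_fields A"
  by (simp add: vector_fields_def tangent_space_diff smooth_functions_diff)

text \<open>Additivity in the second argument forces this. It removes the summand of the O'Neill
  tensor in which a projection of the argument vanishes.\<close>

lemma affine_connection_zero:
  assumes "smooth_atlas A" "affine_connection A nab" "X \<in> vector_fields A"
  shows "nab X 0 = 0"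
proof -
  have "0 \<in> vector_fields A"
    using vector_fields_diff[OF assms(1,3,3)] by simp
  then have "nab X (0 + 0) = nab X 0 + nab X 0"
    using assms(2,3) unfolding affine_connection_def by blast
  then show ?thesis by simp
qed

text \<open>Applying \<open>R\<close> twice gives negation. \<open>U\<close> and \<open>W\<close>
  are only pointwise tangent, so that the result covers projected fields without a proof that
  projections are smooth.\<close>

lemma endomorphism_field_inj:
  assumes R: "endomorphism_field A R"
    and sq: "\<And>p v. v \<in> tangent_space A p \<Longrightarrow> R p (R p v) = - v"
    and U: "\<And>p. U p \<in> tangent_space A p" and W: "\<And>p. W p \<in> tangent_space A p"
  shows "R \<cdot>\<^sub>e U = R \<cdot>\<^sub>e W \<longleftrightarrow> U = W"
proof
  assume eq: "R \<cdot>\<^sub>e U = R \<cdot>\<^sub>e W"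
  have "U p = W p" for p
  proof -
    have "R p (U p) = R p (W p)"
      using fun_cong[OF eq, of p] by (simp add: app_field_def)
    then have "- U p = - W p"
      using sq U W by metis
    then show ?thesis by (metis minus_minus)
  qed
  then show "U = W" ..
qed simp

section \<open>Orthogonal splittings of the tangent bundle\<close>

locale orth_splitting =
  fixes A :: "('a::{t2_space, second_countable_topology}, 'e::euclidean_space) chart set"
    and g :: "'a metric_field" and D :: "'a \<Rightarrow> 'a tvec set"
  assumes metric: "riemannian_metric A g"
    and D_tangent: "\<And>p v. v \<in> D p \<Longrightarrow> v \<in> tangent_space A p"
    and D_diff: "\<And>p v w. v \<in> D p \<Longrightarrow> w \<in> D p \<Longrightarrow> v - w \<in> D p"
    and splitting: "\<And>p u. u \<in> tangent_space A p \<Longrightarrow> \<exists>h\<in>orth A g D p. u - h \<in> D p"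
begin

lemma orth_tangent: "v \<in> orth A g D p \<Longrightarrow> v \<in> tangent_space A p"
  by (simp add: orth_def)

lemma metric_diff:
  assumes "u \<in> tangent_space A p" "v \<in> tangent_space A p" "w \<in> tangent_space A p"
  shows "g p (u - v) w = g p u w - g p v w"
proof -
  have "g p ((u - v) + v) w = g p (u - v) w + g p v w"
    using metric assms tangent_space_diff[OF assms(1,2)] unfolding riemannian_metric_def by blast
  then show ?thesis by simp
qed

lemma orth_diff: "v \<in> orth A g D p \<Longrightarrow> w \<in> orth A g D p \<Longrightarrow> v - w \<in> orth A g D p"
  by (auto simp: orth_def tangent_space_diff metric_diff D_tangent)

lemma D_orth_eq_zero:
  assumes "v \<in> D p" "v \<in> orth A g D p"
  shows "v = 0"
proof (rule ccontr)
  assume "v \<noteq> 0"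
  then have "g p v v > 0"
    using metric D_tangent[OF assms(1)] unfolding riemannian_metric_def by blast
  then show False
    using assms by (auto simp: orth_def)
qed

text \<open>The difference of two candidates lies both in \<open>D\<close> and in its complement,
  where definiteness of the metric leaves only zero. This justifies the definite descriptions in
  \<open>tan_part\<close> and \<open>orth_part\<close>.\<close>

lemma splitting_unique:
  assumes "v \<in> D p" "u - v \<in> orth A g D p" "v' \<in> D p" "u - v' \<in> orth A g D p"
  shows "v = v'"
proof -
  have "v - v' \<in> orth A g D p"
    using orth_diff[OF assms(4,2)] by simp
  then show ?thesis
    using D_orth_eq_zero D_diff assms(1,3) by (metis eq_iff_diff_eq_0)
qed

lemma tan_part_eq:
  assumes "v \<in> D p" "U p - v \<in> orth A g D p"
  shows "tan_part A g D U p = v"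
  unfolding tan_part_def using assms by (blast intro: splitting_unique)

lemma orth_part_eq:
  assumes "h \<in> orth A g D p" "U p - h \<in> D p"
  shows "orth_part A g D U p = h"
  unfolding orth_part_def
proof (rule the_equality)
  fix h' assume "h' \<in> orth A g D p \<and> U p - h' \<in> D p"
  \<comment> \<open>Both sides are \<open>D\<close>-components of \<open>U p\<close>, so uniqueness
    applies to them.\<close>
  then have "U p - h = U p - h'"
    using assms by (intro splitting_unique[where u = "U p"]) auto
  then show "h' = h" by simp
qed (use assms in blast)

lemma tan_part_split:
  assumes "U p \<in> tangent_space A p"
  shows "tan_part A g D U p \<in> D p" "U p - tan_part A g D U p \<in> orth A g D p"
proof -
  obtain h where "h \<in> orth A g D p" "U p - h \<in> D p"
    using splitting assms by blast
  moreover from this have "tan_part A g D U p = U p - h"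
    by (intro tan_part_eq) auto
  ultimately show "tan_part A g D U p \<in> D p" "U p - tan_part A g D U p \<in> orth A g D p"
    by auto
qed

lemma zero_in_D: "0 \<in> D p" and zero_in_orth: "0 \<in> orth A g D p"
proof -
  have z: "0 \<in> tangent_space A p"
    by (simp add: tangent_space_def)
  \<comment> \<open>Splitting the zero vector supplies a member of each summand; subtracting each
    from itself gives zero.\<close>
  obtain h where "h \<in> orth A g D p" "0 - h \<in> D p"
    using splitting[OF z] by blast
  then show "0 \<in> D p" "0 \<in> orth A g D p"
    using D_diff[of "0 - h" p "0 - h"] orth_diff[of h p h] by auto
qed

lemma parts_of_D:
  assumes "\<And>p. U p \<in> D p"
  shows "tan_part A g D U = U" "orth_part A g D U = 0"
  \<comment> \<open>The type instantiation restricts extensionality to points of the manifold;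
    tangent vectors are functions too and must not be unfolded.\<close>
  using assms zero_in_D zero_in_orth by (auto intro!: ext[where 'a = 'a] tan_part_eq orth_part_eq)

lemma parts_of_orth:
  assumes "\<And>p. U p \<in> orth A g D p"
  shows "tan_part A g D U = 0" "orth_part A g D U = U"
  using assms zero_in_D zero_in_orth by (auto intro!: ext[where 'a = 'a] tan_part_eq orth_part_eq)

text \<open>By linearity \<open>R\<close> maps the decomposition of \<open>U p\<close> to one of
  \<open>R p (U p)\<close> with the same roles, and uniqueness identifies its components.\<close>

lemma tan_part_preserving:
  assumes R: "endomorphism_field A R"
    and "\<And>p v. v \<in> D p \<Longrightarrow> R p v \<in> D p"
    and "\<And>p v. v \<in> orth A g D p \<Longrightarrow> R p v \<in> orth A g D p"
    and U: "\<And>p. U p \<in> tangent_space A p"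
  shows "tan_part A g D (R \<cdot>\<^sub>e U) = R \<cdot>\<^sub>e tan_part A g D U"
proof
  fix p
  let ?v = "tan_part A g D U p" and ?h = "U p - tan_part A g D U p"
  have "R p (?h + ?v) = R p ?h + R p ?v"
    using R tan_part_split[of U p, OF U] D_tangent orth_tangent
    unfolding endomorphism_field_def by blast
  then have "R p (U p) - R p ?v = R p ?h"
    by (simp add: algebra_simps)
  then show "tan_part A g D (R \<cdot>\<^sub>e U) p = (R \<cdot>\<^sub>e tan_part A g D U) p"
    using tan_part_split[of U p, OF U] assms(2,3)
    by (auto simp: app_field_def intro!: tan_part_eq)
qed

text \<open>As for a preserving \<open>R\<close>, except that the image of the
  \<open>D\<close>-component is now the orthogonal component.\<close>

lemma orth_part_exchanging:
  assumes R: "endomorphism_field A R"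
    and "\<And>p v. v \<in> D p \<Longrightarrow> R p v \<in> orth A g D p"
    and "\<And>p v. v \<in> orth A g D p \<Longrightarrow> R p v \<in> D p"
    and U: "\<And>p. U p \<in> tangent_space A p"
  shows "orth_part A g D (R \<cdot>\<^sub>e U) = R \<cdot>\<^sub>e tan_part A g D U"
proof
  fix p
  let ?v = "tan_part A g D U p" and ?h = "U p - tan_part A g D U p"
  have "R p (?h + ?v) = R p ?h + R p ?v"
    using R tan_part_split[of U p, OF U] D_tangent orth_tangent
    unfolding endomorphism_field_def by blast
  then have "R p (U p) - R p ?v = R p ?h"
    by (simp add: algebra_simps)
  then show "orth_part A g D (R \<cdot>\<^sub>e U) p = (R \<cdot>\<^sub>e tan_part A g D U) p"
    using tan_part_split[of U p, OF U] assms(2,3)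
    by (auto simp: app_field_def intro!: orth_part_eq)
qed

text \<open>A vector of the complement is \<open>R p w\<close> with \<open>w\<close> in
  \<open>D p\<close>, and a second application of \<open>R\<close> returns
  \<open>- w\<close>.\<close>

lemma exchanging_orth:
  assumes "\<And>v. v \<in> D p \<Longrightarrow> R p (R p v) = - v" "R p ` D p = orth A g D p"
    and "v \<in> orth A g D p"
  shows "R p v \<in> D p"
proof -
  obtain w where "w \<in> D p" "v = R p w"
    using assms by auto
  then show ?thesis
    using assms(1) D_diff[OF zero_in_D, of w] by simp
qed

text \<open>Since \<open>R\<close> maps \<open>D p\<close> onto itself, each test vector is
  \<open>R p w'\<close> with \<open>w'\<close> in \<open>D p\<close>, and the isometry reduces the
  product to that of \<open>v\<close> and \<open>w'\<close>.\<close>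

lemma preserving_orth:
  assumes "endomorphism_field A R" "R p ` D p = D p" "v \<in> orth A g D p"
    and "\<And>v w. v \<in> tangent_space A p \<Longrightarrow> w \<in> tangent_space A p \<Longrightarrow> g p (R p v) (R p w) = g p v w"
  shows "R p v \<in> orth A g D p"
proof -
  have "g p (R p v) w = 0" if "w \<in> D p" for w
  proof -
    have "w \<in> R p ` D p"
      unfolding assms(2) by (rule that)
    then obtain w' where "w' \<in> D p" "w = R p w'" ..
    then show ?thesis
      using assms(3,4) D_tangent by (auto simp: orth_def)
  qed
  moreover have "R p v \<in> tangent_space A p"
    using assms(1) orth_tangent[OF assms(3)] by (auto simp: endomorphism_field_def)
  ultimately show ?thesis
    by (simp add: orth_def)
qed

text \<open>Torsion-freeness makes the bracket \<open>nab X Y - nab Y X\<close>, and such a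
  difference is orthogonal to \<open>D\<close> exactly when the \<open>D\<close>-components
  agree.\<close>

lemma integrable_orth_iff:
  assumes atlas: "smooth_atlas A" and lc: "levi_civita A g nab"
  shows "integrable_distribution A (orth A g D) \<longleftrightarrow>
    (\<forall>X\<in>sections A (orth A g D). \<forall>Y\<in>sections A (orth A g D).
       tan_part A g D (nab X Y) = tan_part A g D (nab Y X))"
proof -
  have "lie_bracket X Y \<in> sections A (orth A g D) \<longleftrightarrow>
      tan_part A g D (nab X Y) = tan_part A g D (nab Y X)"
    if "X \<in> sections A (orth A g D)" "Y \<in> sections A (orth A g D)" for X Y
  proof -
    have X: "X \<in> vector_fields A" and Y: "Y \<in> vector_fields A"
      using that by (auto simp: sections_def)
    have nab: "nab X Y \<in> vector_fields A" "nab Y X \<in> vector_fields A"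
      and br: "lie_bracket X Y = nab X Y - nab Y X"
      using lc X Y unfolding levi_civita_def affine_connection_def by auto
    have "nab X Y p - nab Y X p \<in> orth A g D p \<longleftrightarrow>
        tan_part A g D (nab X Y) p = tan_part A g D (nab Y X) p" for p
    proof -
      let ?v = "tan_part A g D (nab X Y) p" and ?w = "tan_part A g D (nab Y X) p"
      note v = tan_part_split[of "nab X Y" p, OF vector_fields_tangent[OF nab(1)]]
      note w = tan_part_split[of "nab Y X" p, OF vector_fields_tangent[OF nab(2)]]
      show ?thesis
      proof
        assume *: "nab X Y p - nab Y X p \<in> orth A g D p"
        \<comment> \<open>Subtracting the assumed orthogonal difference from
          \<open>nab X Y p - ?v\<close> shows that \<open>?v\<close> is also the
          \<open>D\<close>-component of \<open>nab Y X p\<close>.\<close>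
        have "nab Y X p - ?v \<in> orth A g D p"
          using orth_diff[OF v(2) *] by (simp add: algebra_simps)
        then show "?v = ?w"
          using splitting_unique[OF v(1) _ w] by blast
      next
        assume "?v = ?w"
        then show "nab X Y p - nab Y X p \<in> orth A g D p"
          using orth_diff[OF v(2) w(2)] by simp
      qed
    qed
    then show ?thesis
      using vector_fields_diff[OF atlas nab] by (auto simp: br sections_def fun_eq_iff[where 'a = 'a])
  qed
  then show ?thesis
    unfolding integrable_distribution_def by blast
qed

end

section \<open>The vertical distribution and the O'Neill tensor\<close>

lemma orth_splitting_ker_diff:
  assumes "riemannian_metric A gM" "riemannian_submersion A gM B gN F"
  shows "orth_splitting A gM (ker_diff A B F)"
proof
  have diff: "differential B F (u - v) = differential B F u - differential B F v" for u v
    by (auto simp: differential_def)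
  show "v - w \<in> ker_diff A B F p" if "v \<in> ker_diff A B F p" "w \<in> ker_diff A B F p" for p v w
    using that by (simp add: ker_diff_def tangent_space_diff diff)
  fix p u assume u: "u \<in> tangent_space A p"
  \<comment> \<open>The differential maps the horizontal space onto the tangent space of the target,
    so \<open>u\<close> has the same image as some horizontal \<open>h\<close>; then
    \<open>u - h\<close> is vertical. No dimension count is involved.\<close>
  then have "differential B F u \<in> differential B F ` orth A gM (ker_diff A B F) p"
    using assms(2) unfolding riemannian_submersion_def bij_betw_def by blast
  then obtain h where "h \<in> orth A gM (ker_diff A B F) p" "differential B F u = differential B F h"
    by auto
  then show "\<exists>h\<in>orth A gM (ker_diff A B F) p. u - h \<in> ker_diff A B F p"
    using u by (intro bexI[of _ h]) (auto simp: ker_diff_def orth_def tangent_space_diff diff)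
qed (use assms in \<open>auto simp: ker_diff_def\<close>)

text \<open>The horizontal part of \<open>W\<close> is zero, so the second summand is the vertical
  part of \<open>nab X 0\<close>, which vanishes.\<close>

lemma oneill_A_vertical:
  assumes "orth_splitting A g (ker_diff A B F)" "smooth_atlas A" "affine_connection A nab"
    and X: "X \<in> sections A (orth A g (ker_diff A B F))" and W: "\<And>p. W p \<in> ker_diff A B F p"
  shows "oneill_A A g nab B F X W = orth_part A g (ker_diff A B F) (nab X W)"
proof -
  interpret orth_splitting A g "ker_diff A B F" by fact
  have "X \<in> vector_fields A" "\<And>p. X p \<in> orth A g (ker_diff A B F) p"
    using X by (auto simp: sections_def)
  then show ?thesis
    using W parts_of_D(1)[of 0] zero_in_D
    by (simp add: oneill_A_def parts_of_D parts_of_orth affine_connection_zero[OF assms(2,3)])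
qed

lemma oneill_A_horizontal:
  assumes "orth_splitting A g (ker_diff A B F)" "smooth_atlas A" "affine_connection A nab"
    and X: "X \<in> sections A (orth A g (ker_diff A B F))"
    and W: "\<And>p. W p \<in> orth A g (ker_diff A B F) p"
  shows "oneill_A A g nab B F X W = tan_part A g (ker_diff A B F) (nab X W)"
proof -
  interpret orth_splitting A g "ker_diff A B F" by fact
  have "X \<in> vector_fields A" "\<And>p. X p \<in> orth A g (ker_diff A B F) p"
    using X by (auto simp: sections_def)
  then show ?thesis
    using W parts_of_D(2)[of 0] zero_in_D
    by (simp add: oneill_A_def parts_of_orth affine_connection_zero[OF assms(2,3)])
qed

theorem lemma3p10:
  fixes A :: "('a::{t2_space, second_countable_topology}, 'e::euclidean_space) chart set"
    and B :: "('b::{t2_space, second_countable_topology}, 'f::euclidean_space) chart set"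
    and gM :: "'a metric_field" and gN :: "'b metric_field"
    and nab :: "'a vfield \<Rightarrow> 'a vfield \<Rightarrow> 'a vfield"
    and I J K :: "'a endo_field"
    and F :: "'a \<Rightarrow> 'b"
  defines "H \<equiv> orth A gM (ker_diff A B F)"
  defines "\<A> \<equiv> oneill_A A gM nab B F"
  assumes "hyperkaehler A gM nab I J K"
    and "riemannian_manifold B gN"
    and "h_lagrangian_submersion A gM B gN F I J K"
  shows "(integrable_distribution A H
            \<longleftrightarrow> (\<forall>X\<in>sections A H. \<forall>Y\<in>sections A H. \<A> X (I \<cdot>\<^sub>e Y) = \<A> Y (I \<cdot>\<^sub>e X))) \<and>
         (integrable_distribution A H
            \<longleftrightarrow> (\<forall>X\<in>sections A H. \<forall>Y\<in>sections A H. \<A> X (K \<cdot>\<^sub>e Y) = \<A> Y (K \<cdot>\<^sub>e X))) \<and>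
         (integrable_distribution A H
            \<longleftrightarrow> (\<forall>X\<in>sections A H. \<forall>Y\<in>sections A H. \<A> X (J \<cdot>\<^sub>e Y) = \<A> Y (J \<cdot>\<^sub>e X)))"
proof -
  let ?D = "ker_diff A B F" and ?RH = "{I, J, K}"
  have atlas: "smooth_atlas A" and metric: "riemannian_metric A gM" and lc: "levi_civita A gM nab"
    using assms(3) unfolding hyperkaehler_def riemannian_manifold_def by blast+
  have conn: "affine_connection A nab"
    using lc unfolding levi_civita_def by blast
  have R_props: "\<forall>R\<in>?RH. endomorphism_field A R \<and>
      (\<forall>p. \<forall>v\<in>tangent_space A p. R p (R p v) = - v) \<and>
      (\<forall>p. \<forall>v\<in>tangent_space A p. \<forall>w\<in>tangent_space A p. gM p (R p v) (R p w) = gM p v w) \<and>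
      (\<forall>X\<in>vector_fields A. \<forall>Y\<in>vector_fields A. nab X (R \<cdot>\<^sub>e Y) - R \<cdot>\<^sub>e nab X Y = 0)"
    using assms(3) unfolding hyperkaehler_def by (elim conjE)
  have endo: "endomorphism_field A R"
    and sq: "\<And>p v. v \<in> tangent_space A p \<Longrightarrow> R p (R p v) = - v"
    and isom: "\<And>p v w. v \<in> tangent_space A p \<Longrightarrow> w \<in> tangent_space A p \<Longrightarrow>
      gM p (R p v) (R p w) = gM p v w"
    and parallel: "\<And>X Y. X \<in> vector_fields A \<Longrightarrow> Y \<in> vector_fields A \<Longrightarrow>
      nab X (R \<cdot>\<^sub>e Y) = R \<cdot>\<^sub>e nab X Y"
    if "R \<in> ?RH" for R
    using bspec[OF R_props that] by simp_all
  have sub: "riemannian_submersion A gM B gN F"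
    and I: "\<And>p. I p ` ?D p = H p" and J: "\<And>p. J p ` ?D p = ?D p" and K: "\<And>p. K p ` ?D p = H p"
    using assms(5) unfolding h_lagrangian_submersion_def H_def by blast+
  have os: "orth_splitting A gM ?D"
    using metric sub by (rule orth_splitting_ker_diff)
  interpret orth_splitting A gM ?D by (rule os)
  have key: "\<A> X (R \<cdot>\<^sub>e Y) = R \<cdot>\<^sub>e tan_part A gM ?D (nab X Y)"
    if R: "R \<in> ?RH" and X: "X \<in> sections A H" and Y: "Y \<in> sections A H" for R X Y
  proof -
    have vf: "X \<in> vector_fields A" "Y \<in> vector_fields A" and Yh: "\<And>p. Y p \<in> H p"
      using X Y by (auto simp: sections_def)
    have t: "nab X Y p \<in> tangent_space A p" for p
      using conn vf unfolding affine_connection_def by (blast intro: vector_fields_tangent)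
    \<comment> \<open>\<open>I\<close> and \<open>K\<close> are treated together, as only the
      exchange of the two distributions matters for them.\<close>
    consider "R = J" | "\<And>p. R p ` ?D p = H p"
      using R I K by blast
    then show ?thesis
    proof cases
      case 1
      have JD: "\<And>p v. v \<in> ?D p \<Longrightarrow> J p v \<in> ?D p"
        using J by blast
      have JH: "\<And>p v. v \<in> H p \<Longrightarrow> J p v \<in> H p"
        unfolding H_def by (rule preserving_orth[OF endo J]) (simp_all add: isom)
      have "\<A> X (J \<cdot>\<^sub>e Y) = tan_part A gM ?D (nab X (J \<cdot>\<^sub>e Y))"
        unfolding \<A>_def using X JH Yh
        by (intro oneill_A_horizontal[OF os atlas conn]) (auto simp: H_def app_field_def)
      then show ?thesis
        using JD JH t parallel[OF R vf] endo unfolding 1 H_def by (simp add: tan_part_preserving)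
    next
      case 2
      have RD: "\<And>p v. v \<in> ?D p \<Longrightarrow> R p v \<in> H p"
        using 2 by blast
      have RH: "\<And>p v. v \<in> H p \<Longrightarrow> R p v \<in> ?D p"
        unfolding H_def by (rule exchanging_orth[OF sq[OF R D_tangent] 2[unfolded H_def]])
      have "\<A> X (R \<cdot>\<^sub>e Y) = orth_part A gM ?D (nab X (R \<cdot>\<^sub>e Y))"
        unfolding \<A>_def using X RH Yh
        by (intro oneill_A_vertical[OF os atlas conn]) (auto simp: H_def app_field_def)
      then show ?thesis
        using RD RH t parallel[OF R vf] endo[OF R] unfolding H_def by (simp add: orth_part_exchanging)
    qed
  qed
  have "integrable_distribution A H \<longleftrightarrow>
      (\<forall>X\<in>sections A H. \<forall>Y\<in>sections A H. \<A> X (R \<cdot>\<^sub>e Y) = \<A> Y (R \<cdot>\<^sub>e X))" if R: "R \<in> ?RH" for R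
  proof -
    have "\<A> X (R \<cdot>\<^sub>e Y) = \<A> Y (R \<cdot>\<^sub>e X) \<longleftrightarrow>
        tan_part A gM ?D (nab X Y) = tan_part A gM ?D (nab Y X)"
      if X: "X \<in> sections A H" and Y: "Y \<in> sections A H" for X Y
    proof -
      have "nab X Y \<in> vector_fields A" "nab Y X \<in> vector_fields A"
        using conn X Y unfolding affine_connection_def sections_def by blast+
      \<comment> \<open>Pointwise tangency of the vertical parts is what cancelling \<open>R\<close>
        requires.\<close>
      then have "\<And>p. tan_part A gM ?D (nab X Y) p \<in> tangent_space A p"
        "\<And>p. tan_part A gM ?D (nab Y X) p \<in> tangent_space A p"
        by (auto intro: D_tangent tan_part_split vector_fields_tangent)
      then show ?thesis
        unfolding key[OF R X Y] key[OF R Y X]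
        by (intro endomorphism_field_inj[OF endo[OF R] sq[OF R]])
    qed
    then show ?thesis
      using integrable_orth_iff[OF atlas lc] unfolding H_def by blast
  qed
  then show ?thesis by blast
qed

end
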